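(* Let $t\ge 2$, let $p_1,\dots,p_t\ge 1$ be integers, $n=\sum_{i=1}^t p_i$, let $G=K_{p_1,p_2,\ldots,p_t}$ be the complete $t$-partite graph with part sizes $p_1,\ldots,p_t$, and let $d_i=n-p_i$ be the common degree of the vertices in the $i$-th part. Let $\phi$ be a symmetric real-valued function, nonzero on the degree pairs that occur on edges of $G$, and let $\dot A(G)$ be the associated degree-based weighted adjacency matrix. Let $M=(m_{ij})_{t\times t}$ with $m_{ii}=0$ and $m_{ij}=p_j\phi(d_i,d_j)$ for $i\ne j$. Let $D=\operatorname{diag}(p_1,\ldots,p_t)$ and $S=D^{1/2}MD^{-1/2}=(s_{ij})_{t\times t}$. Then: (1) $s_{ii}=0$ and $s_{ij}=\sqrt{p_ip_j}\,\phi(d_i,d_j)$ for $i\neq j$; in particular $S$ is a real symmetric matrix and $M$ is similar to $S$. (2) $\chi_{\dot A(G)}(x)=x^{n-t}\det(xI_t-S)$. (3) $\operatorname{Spec}(\dot A(G))=\{0^{[n-t]}\}\uplus\operatorname{Spec}(S)=\{0^{[n-t]}\}\uplus\operatorname{Spec}(M)$. (4) $\operatorname{rank}\dot A(G)=\operatorname{rank}S$ and the multiplicity of $0$ as an eigenvalue of $\dot A(G)$ equals $n-t+\dim\ker S$. Hence the multiplicity of $0$ is exactly $n-t$ if and only if $S$ is nonsingular.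
   Context: Graphs are finite, simple and undirected. For a symmetric function $\phi:\mathbb R_{>0}\times\mathbb R_{>0}\to\mathbb R$, $\phi(x,y)=\phi(y,x)$, and a graph $G$ with vertices $v_1,\dots,v_n$ of degrees $d(v_1),\dots,d(v_n)$, the degree-based weighted adjacency matrix $\dot A(G)$ is the $n\times n$ real symmetric matrix whose $(i,j)$ entry is $\phi(d(v_i),d(v_j))$ if $v_i$ and $v_j$ are adjacent, and $0$ otherwise. $\operatorname{Spec}(M)$ is the multiset of eigenvalues of $M$; $\lambda^{[k]}$ means $\lambda$ repeated with multiplicity $k$; $\uplus$ is multiset union; $\chi_M(x)=\det(xI-M)$. The complete multipartite graph $K_{p_1,\ldots,p_t}$ has vertex set partitioned into independent sets of sizes $p_1,\ldots,p_t$, with any two vertices of different parts adjacent. *)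

theory Defs
  imports
    "Graph_Theory.Digraph"
    "Jordan_Normal_Form.Char_Poly"
    "Jordan_Normal_Form.Matrix_Kernel"
    "Jordan_Normal_Form.DL_Rank"
    "HOL-Library.Multiset"
    Complex_Main
begin

text \<open>
  A finite simple undirected graph is a \<^locale>\<open>graph\<close> of the Graph Theory library: a finite
  symmetric digraph without loops or multiple arcs. Each undirected edge is a pair of opposite
  arcs, so the degree of a vertex is its \<^const>\<open>out_degree\<close>.
\<close>

definition complete_multipartite :: "('a, 'b) pre_digraph \<Rightarrow> nat \<Rightarrow> (nat \<Rightarrow> 'a set) \<Rightarrow> bool" where
  "complete_multipartite G t P \<longleftrightarrow>
     graph G \<and> verts G = (\<Union>i<t. P i) \<and> disjoint_family_on P {..<t} \<and>
     arcs_ends G = (\<Union>i<t. \<Union>j\<in>{..<t} - {i}. P i \<times> P j)"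

text \<open>The list \<open>vs\<close> is the enumeration \<open>v\<^sub>1, \<dots>, v\<^sub>n\<close> of the vertices that indexes rows and columns.\<close>

definition weighted_adjacency_mat ::
    "(real \<Rightarrow> real \<Rightarrow> real) \<Rightarrow> ('a, 'b) pre_digraph \<Rightarrow> 'a list \<Rightarrow> real mat" where
  "weighted_adjacency_mat \<phi> G vs = mat (length vs) (length vs) (\<lambda>(i, j).
     if vs ! i \<rightarrow>\<^bsub>G\<^esub> vs ! j
     then \<phi> (real (out_degree G (vs ! i))) (real (out_degree G (vs ! j))) else 0)"

text \<open>
  Eigenvalues are counted with algebraic multiplicity and taken over the complex numbers, so that
  no eigenvalue of a non-symmetric real matrix is lost.
\<close>

definition Spec :: "real mat \<Rightarrow> complex multiset" where
  "Spec A = proots (char_poly (map_mat complex_of_real A))"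

text \<open>The power \<open>D\<^sup>a\<close>; only meaningful for a diagonal matrix with positive diagonal entries.\<close>

definition diag_mat_powr :: "real mat \<Rightarrow> real \<Rightarrow> real mat" where
  "diag_mat_powr D a = mat_diag (dim_row D) (\<lambda>i. (D $$ (i, i)) powr a)"

end

theory Submission
  imports
    Defs
    "Jordan_Normal_Form.Jordan_Normal_Form_Existence"
    "Jordan_Normal_Form.Jordan_Normal_Form_Uniqueness"
begin

text \<open>
  All vertices in one part of a complete multipartite graph have the same degree, so the entry of
  the weighted adjacency matrix \<open>A\<close> at \<open>(u, v)\<close> depends only on the parts of \<open>u\<close> and \<open>v\<close>. Hence
  \<open>A = U S U\<^sup>T\<close>, where column \<open>i\<close> of the \<open>n \<times> t\<close> matrix \<open>U\<close> is the indicator vector of part \<open>i\<close>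
  divided by its length \<open>\<surd>(p i)\<close>; these columns are orthonormal, so \<open>U\<^sup>T U = 1\<close>
  (\<open>blow_up_factorization\<close>).

  The matrices \<open>U (S U\<^sup>T)\<close> and \<open>(S U\<^sup>T) U = S\<close> are the two products of the same two factors. By
  Sylvester's identity (\<open>char_poly_mult_commute\<close>) their characteristic polynomials differ by the
  factor \<open>x ^ (n - t)\<close>. This gives the factorization of the characteristic polynomial and the
  spectrum; \<open>M\<close> has the spectrum of \<open>S\<close> because the two are conjugate by a diagonal matrix.

  For a real symmetric matrix, the algebraic multiplicity of 0 is the dimension of the kernel
  (\<open>symmetric_real_order_0_char_poly\<close>), because the matrix and its square have the same kernel and so
  all Jordan blocks for 0 have size 1. Applied to \<open>S\<close>, this turns the factorization into the formula
  for the multiplicity of 0 in the spectrum of \<open>A\<close>; applied to \<open>A\<close> as well, it relates the two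
  kernels, and the equality of the ranks follows by rank-nullity (\<open>rank_plus_kernel_dim\<close>).
\<close>

section \<open>Characteristic polynomials of products\<close>

lemma char_poly_four_block_upper_right_zero:
  fixes A :: "'a :: idom mat"
  assumes A: "A \<in> carrier_mat n n" and C: "C \<in> carrier_mat m n" and D: "D \<in> carrier_mat m m"
  shows "char_poly (four_block_mat A (0\<^sub>m n m) C D) = char_poly A * char_poly D"
proof -
  have "char_poly_matrix (four_block_mat A (0\<^sub>m n m) C D)
      = four_block_mat (char_poly_matrix A) (0\<^sub>m n m) (map_mat (\<lambda>a. [:- a:]) C) (char_poly_matrix D)"
    unfolding char_poly_matrix_def
    by (rule eq_matI) (use A C D in \<open>auto simp: one_poly_def\<close>)
  then show ?thesis
    unfolding char_poly_def
    using det_four_block_mat_upper_right_zero[OF char_poly_matrix_closed[OF A] refl _ char_poly_matrix_closed[OF D]] C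
    by simp
qed

lemma char_poly_zero_mat: "char_poly (0\<^sub>m n n :: 'a :: idom mat) = [:0, 1:] ^ n"
proof -
  have "char_poly_matrix (0\<^sub>m n n :: 'a mat) = [:0, 1:] \<cdot>\<^sub>m 1\<^sub>m n"
    unfolding char_poly_matrix_def by (rule eq_matI) auto
  then show ?thesis
    unfolding char_poly_def by (simp add: det_smult)
qed

text \<open>
  Sylvester's identity. The block matrices with rows \<open>(B C, 0), (C, 0)\<close> and
  \<open>(0, 0), (C, C B)\<close> are conjugate by the unipotent matrix with rows \<open>(1, B), (0, 1)\<close>,
  so they have the same characteristic polynomial, and both are block triangular.
\<close>

lemma char_poly_mult_commute:
  fixes B C :: "'a :: idom mat"
  assumes B: "B \<in> carrier_mat n m" and C: "C \<in> carrier_mat m n"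
  shows "[:0, 1:] ^ m * char_poly (B * C) = [:0, 1:] ^ n * char_poly (C * B)"
proof -
  define L where "L = four_block_mat (B * C) (0\<^sub>m n m) C (0\<^sub>m m m)"
  define R where "R = four_block_mat (0\<^sub>m n n) (0\<^sub>m n m) C (C * B)"
  define P where "P = four_block_mat (1\<^sub>m n) B (0\<^sub>m m n) (1\<^sub>m m)"
  define Q where "Q = four_block_mat (1\<^sub>m n) (- B) (0\<^sub>m m n) (1\<^sub>m m)"
  have BC: "B * C \<in> carrier_mat n n" and CB: "C * B \<in> carrier_mat m m" using B C by auto
  have carr: "{L, R, P, Q} \<subseteq> carrier_mat (n + m) (n + m)"
    unfolding L_def R_def P_def Q_def using B C by auto
  have uB: "- B \<in> carrier_mat n m" using B by auto
  have one: "four_block_mat (1\<^sub>m n) (0\<^sub>m n m) (0\<^sub>m m n) (1\<^sub>m m) = (1\<^sub>m (n + m) :: 'a mat)"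
    by (rule eq_matI) auto
  have minus_zero: "- 0\<^sub>m m m = (0\<^sub>m m m :: 'a mat)"
    by (rule eq_matI) auto
  have right_inv: "B + - B = 0\<^sub>m n m"
    by (rule eq_matI) (use B in auto)
  have PQ: "P * Q = 1\<^sub>m (n + m)"
    unfolding P_def Q_def one[symmetric]
    by (subst mult_four_block_mat[OF one_carrier_mat B zero_carrier_mat one_carrier_mat
          one_carrier_mat uB zero_carrier_mat one_carrier_mat])
      (use B minus_zero uminus_l_inv_mat[OF B] in simp)
  have QP: "Q * P = 1\<^sub>m (n + m)"
    unfolding P_def Q_def one[symmetric]
    by (subst mult_four_block_mat[OF one_carrier_mat uB zero_carrier_mat one_carrier_mat
          one_carrier_mat B zero_carrier_mat one_carrier_mat]) (use B right_inv in simp)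
  \<comment> \<open>The conjugation is checked without inverses, in the form \<open>L P = P R\<close>.\<close>
  have LP: "L * P = four_block_mat (B * C) (B * C * B) C (C * B)"
    unfolding L_def P_def
    by (subst mult_four_block_mat[OF BC zero_carrier_mat C zero_carrier_mat
          one_carrier_mat B zero_carrier_mat one_carrier_mat]) (use B C BC CB in simp)
  have PR: "P * R = four_block_mat (B * C) (B * C * B) C (C * B)"
    unfolding P_def R_def
    by (subst mult_four_block_mat[OF one_carrier_mat B zero_carrier_mat one_carrier_mat
          zero_carrier_mat zero_carrier_mat C CB]) (use B C BC CB in \<open>simp\<close>)
  have "L = L * (P * Q)" using carr by (simp add: PQ right_mult_one_mat[of L "n + m" "n + m"])
  also have "\<dots> = L * P * Q" using carr assoc_mult_mat[of L "n + m" "n + m" P "n + m" Q "n + m"] by auto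
  also have "\<dots> = P * R * Q" by (simp only: LP PR)
  finally have "L = P * R * Q" .
  then have "similar_mat L R" using carr PQ QP by (intro similar_matI) auto
  then have "char_poly L = char_poly R" by (rule char_poly_similar)
  then show ?thesis
    unfolding L_def R_def
    using char_poly_four_block_upper_right_zero[OF BC C zero_carrier_mat]
      char_poly_four_block_upper_right_zero[OF zero_carrier_mat C CB]
    by (simp add: char_poly_zero_mat mult.commute)
qed

text \<open>
  The case of Sylvester's identity with \<open>B = U\<close> and \<open>C = S U\<^sup>T\<close>: here \<open>C B = S U\<^sup>T U = S\<close>.
\<close>

lemma char_poly_isometric_conjugate:
  fixes U :: "'a :: idom mat"
  assumes U: "U \<in> carrier_mat n t" and S: "S \<in> carrier_mat t t" and "t \<le> n"
    and iso: "transpose_mat U * U = 1\<^sub>m t"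
  shows "char_poly (U * S * transpose_mat U) = [:0, 1:] ^ (n - t) * char_poly S"
proof -
  have UT: "transpose_mat U \<in> carrier_mat t n" using U by simp
  have SUT: "S * transpose_mat U \<in> carrier_mat t n" using S UT by simp
  have "[:0, 1:] ^ t * char_poly (U * (S * transpose_mat U))
      = [:0, 1:] ^ n * char_poly (S * transpose_mat U * U)"
    by (rule char_poly_mult_commute[OF U SUT])
  also have "S * transpose_mat U * U = S"
    using assoc_mult_mat[OF S UT U] iso S by simp
  also have "[:0, 1 :: 'a:] ^ n = [:0, 1:] ^ t * [:0, 1:] ^ (n - t)"
    using \<open>t \<le> n\<close> by (simp flip: power_add)
  finally show ?thesis
    using assoc_mult_mat[OF U S UT] by (simp add: mult.assoc)
qed

section \<open>Rank, kernel and the multiplicity of the eigenvalue 0\<close>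

text \<open>
  This is the rank-nullity theorem for \<open>v \<mapsto> A v\<close>: the image of this map is the column space of \<open>A\<close>,
  whose dimension is the rank by definition.
\<close>

lemma rank_plus_kernel_dim:
  fixes A :: "'a :: field mat"
  assumes A: "A \<in> carrier_mat n nc"
  shows "vec_space.rank n A + kernel_dim A = nc"
proof -
  interpret W: vec_space "TYPE('a)" n .
  interpret K: kernel n nc A by unfold_locales (rule A)
  interpret T: linear_map class_ring K.NC.V W.V "\<lambda>v. A *\<^sub>v v"
    by unfold_locales (use A in \<open>auto simp: module_hom_def mult_add_distrib_mat_vec[of A n nc]
      mult_mat_vec[of A n nc] class_ring_simps\<close>)
  have im: "T.imT = W.col_space A"
    unfolding T.im_def W.col_space_eq[OF A] using A by (auto simp: image_def)
  have ker: "T.kerT = mat_kernel A"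
    unfolding T.ker_def mat_kernel[OF A] by auto
  show ?thesis
    using T.rank_nullity[OF K.NC.fin_dim]
    unfolding im ker W.rank_def W.col_space_def K.kernel_dim K.NC.dim_is_n .
qed

lemma invertible_mat_iff_rank:
  fixes A :: "'a :: field mat"
  assumes A: "A \<in> carrier_mat n n"
  shows "invertible_mat A \<longleftrightarrow> vec_space.rank n A = n"
  unfolding vec_space.det_rank_iff[OF A, symmetric]
proof
  assume "invertible_mat A"
  then obtain B where B: "A * B = 1\<^sub>m n" and BA: "B * A = 1\<^sub>m (dim_row B)"
    unfolding invertible_mat_def inverts_mat_def carrier_matD(1)[OF A] by blast
  have "dim_col (A * B) = n" "dim_col (B * A) = dim_row B" unfolding B BA by auto
  then have BC: "B \<in> carrier_mat n n" using A by (metis carrier_matI carrier_matD(2) index_mult_mat(3))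
  show "det A \<noteq> 0" using det_mult[OF A BC] unfolding B by auto
next
  assume "det A \<noteq> 0"
  from det_non_zero_imp_unit[OF A this, of "()"] obtain B
    where "B \<in> carrier_mat n n" "A * B = 1\<^sub>m n" "B * A = 1\<^sub>m n"
    unfolding Units_def ring_mat_def by auto
  then show "invertible_mat A"
    using A unfolding invertible_mat_def inverts_mat_def by (metis carrier_matD square_mat.simps)
qed

text \<open>
  Over the complex numbers the characteristic polynomial splits, and its roots are real because
  \<open>e \<langle>v, v\<rangle> = \<langle>A v, v\<rangle> = \<langle>v, A v\<rangle> = cnj e \<langle>v, v\<rangle>\<close> for every eigenvector \<open>v\<close>. Splitting over the
  reals is what gives a real Jordan normal form.
\<close>

lemma symmetric_real_char_poly_splits:
  fixes A :: "real mat"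
  assumes A: "A \<in> carrier_mat n n" and sym: "transpose_mat A = A"
  shows "\<exists>as. char_poly A = (\<Prod>a\<leftarrow>as. [:- a, 1:])"
proof -
  interpret mp: map_poly_inj_idom_divide_hom complex_of_real ..
  define C where "C = map_mat complex_of_real A"
  have C: "C \<in> carrier_mat n n" using A by (simp add: C_def)
  have CT: "transpose_mat C = C" using sym unfolding C_def by (metis map_mat_transpose)
  have real: "cnj e = e" if ev: "eigenvalue C e" for e
  proof -
    obtain v where v: "v \<in> carrier_vec n" "v \<noteq> 0\<^sub>v n" "C *\<^sub>v v = e \<cdot>\<^sub>v v"
      using ev unfolding eigenvalue_def eigenvector_def carrier_matD(1)[OF C] by blast
    have "conjugate (C *\<^sub>v v) = C *\<^sub>v conjugate v"
      by (rule eq_vecI) (use v(1) A in \<open>auto simp: C_def scalar_prod_def\<close>)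
    then have cv: "C *\<^sub>v conjugate v = cnj e \<cdot>\<^sub>v conjugate v"
      unfolding v(3) by (simp add: conjugate_smult_vec)
    have "e * (v \<bullet>c v) = (C *\<^sub>v v) \<bullet>c v" unfolding v(3) using v(1) by simp
    also have "\<dots> = v \<bullet> (C *\<^sub>v conjugate v)"
      using transpose_vec_mult_scalar[OF C, of "conjugate v" v, unfolded CT] v(1) by simp
    also have "\<dots> = cnj e * (v \<bullet>c v)" using v(1) unfolding cv by simp
    finally show ?thesis using v(1,2) conjugate_square_eq_0_vec[OF v(1)] by auto
  qed
  obtain as where as: "char_poly C = (\<Prod>a\<leftarrow>as. [:- a, 1:])" using char_poly_factorized[OF C] by blast
  have "a = complex_of_real (Re a)" if "a \<in> set as" for a
  proof -
    have "poly (char_poly C) a = 0"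
      using that unfolding as by (induction as) auto
    then have "cnj a = a" using real eigenvalue_root_char_poly[OF C] by blast
    then show ?thesis by (simp add: complex_eq_iff)
  qed
  then have "map (complex_of_real \<circ> Re) as = as" by (simp add: map_idI)
  then have "char_poly C = (\<Prod>a\<leftarrow>map Re as. [:- complex_of_real a, 1:])"
    unfolding as by (metis (no_types, lifting) comp_apply list.map_comp map_eq_conv)
  also have "\<dots> = map_poly complex_of_real (\<Prod>a\<leftarrow>map Re as. [:- a, 1:])"
    unfolding mp.hom_prod_list by (simp add: o_def of_real_hom.map_poly_pCons_hom)
  finally have "map_poly complex_of_real (char_poly A) = map_poly complex_of_real (\<Prod>a\<leftarrow>map Re as. [:- a, 1:])"
    unfolding C_def of_real_hom.char_poly_hom[OF A] .
  then have "char_poly A = (\<Prod>a\<leftarrow>map Re as. [:- a, 1:])" by (rule mp.injectivity)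
  then show ?thesis by blast
qed

text \<open>
  If \<open>A (A v) = 0\<close> then \<open>\<langle>A v, A v\<rangle> = \<langle>A (A v), v\<rangle> = 0\<close>, and the real inner product is definite.
\<close>

lemma symmetric_real_kernel_square:
  fixes A :: "real mat"
  assumes A: "A \<in> carrier_mat n n" and sym: "transpose_mat A = A"
  shows "mat_kernel (A * A) = mat_kernel A"
proof (intro equalityI subsetI)
  fix v assume "v \<in> mat_kernel (A * A)"
  then have v: "v \<in> carrier_vec n" and AAv: "A *\<^sub>v (A *\<^sub>v v) = 0\<^sub>v n"
    using A by (auto simp: mat_kernel_def)
  have "(A *\<^sub>v v) \<bullet> (A *\<^sub>v v) = (A *\<^sub>v (A *\<^sub>v v)) \<bullet> v"
    using transpose_vec_mult_scalar[OF A v, of "A *\<^sub>v v"] A v sym by simp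
  also have "\<dots> = 0" using v by (simp add: AAv)
  finally have "A *\<^sub>v v = 0\<^sub>v n"
    using conjugate_square_eq_0_vec[of "A *\<^sub>v v" n] A v by simp
  then show "v \<in> mat_kernel A" using A v by (auto simp: mat_kernel_def)
next
  fix v assume "v \<in> mat_kernel A"
  then show "v \<in> mat_kernel (A * A)" using A by (auto simp: mat_kernel_def)
qed

text \<open>
  The Jordan blocks for the eigenvalue 0, of sizes \<open>k\<close>, contribute \<open>k\<close> to the algebraic
  multiplicity and \<open>min j k\<close> to the dimension of the kernel of \<open>A ^ j\<close>. Since \<open>A\<close> and \<open>A A\<close> have
  the same kernel, no block is larger than 1, so algebraic and geometric multiplicity agree.
\<close>

lemma symmetric_real_order_0_char_poly:
  fixes A :: "real mat"
  assumes A: "A \<in> carrier_mat n n" and sym: "transpose_mat A = A"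
  shows "Polynomial.order 0 (char_poly A) = kernel_dim A"
proof -
  obtain n_as where jnf: "jordan_nf A n_as"
    using symmetric_real_char_poly_splits[OF A sym] jordan_nf_iff_linear_factorization[OF A] by blast
  define sizes where "sizes = map fst (filter (\<lambda>(n, e). e = 0) n_as)"
  have cm: "char_matrix A 0 = A" unfolding char_matrix_def by (rule eq_matI) (use A in auto)
  \<comment> \<open>The kernels of \<open>A\<close> and \<open>A A\<close> are the generalized eigenspaces of orders 1 and 2.\<close>
  have "kernel_dim (A * A) = kernel_dim A"
    unfolding kernel_dim_def symmetric_real_kernel_square[OF A sym] using A by simp
  then have "dim_gen_eigenspace A 0 2 = dim_gen_eigenspace A 0 1"
    unfolding dim_gen_eigenspace_def cm using A by (simp add: numeral_2_eq_2)
  then have *: "(\<Sum>k\<leftarrow>sizes. min 2 k) = (\<Sum>k\<leftarrow>sizes. min 1 k)"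
    unfolding dim_gen_eigenspace[OF jnf] sizes_def by simp
  from * have "sum_list sizes = (\<Sum>k\<leftarrow>sizes. min 1 k)"
  proof (induction sizes)
    case (Cons k ks)
    have "(\<Sum>k\<leftarrow>ks. min 1 k) \<le> (\<Sum>k\<leftarrow>ks. min (2::nat) k)" by (rule sum_list_mono) auto
    moreover have "min 1 k \<le> min 2 k" by auto
    ultimately have "min 1 k = min 2 k" "(\<Sum>k\<leftarrow>ks. min 2 k) = (\<Sum>k\<leftarrow>ks. min 1 k)"
      using Cons.prems by auto
    then show ?case using Cons by auto
  qed simp
  also have "\<dots> = dim_gen_eigenspace A 0 1" unfolding dim_gen_eigenspace[OF jnf] sizes_def ..
  also have "\<dots> = kernel_dim A" unfolding dim_gen_eigenspace_def cm using A by simp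
  finally show ?thesis unfolding jordan_nf_order[OF jnf] sizes_def by (simp add: case_prod_unfold)
qed

section \<open>Spectra of real matrices\<close>

lemma Spec_eq_proots_char_poly:
  assumes "A \<in> carrier_mat n n"
  shows "Spec A = proots (map_poly complex_of_real (char_poly A))"
  unfolding Spec_def of_real_hom.char_poly_hom[OF assms] ..

lemma char_poly_nonzero: "(A :: 'a :: idom mat) \<in> carrier_mat n n \<Longrightarrow> char_poly A \<noteq> 0"
  using degree_monic_char_poly[of A n] by auto

lemma count_Spec_0:
  assumes A: "A \<in> carrier_mat n n"
  shows "count (Spec A) 0 = Polynomial.order 0 (char_poly A)"
proof -
  interpret h: map_poly_inj_idom_divide_hom complex_of_real ..
  show ?thesis
    unfolding Spec_eq_proots_char_poly[OF A]
    using h.order_hom[of 0 "char_poly A"] char_poly_nonzero[OF A] by simp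
qed

section \<open>Blow-ups of small matrices\<close>

text \<open>
  A matrix whose entries depend only on the classes of the row and the column is a blow-up of a
  small matrix \<open>W\<close>. The columns of \<open>U\<close> are the indicator vectors of the classes scaled to unit
  length, so they are orthonormal because distinct classes are disjoint. The scaling of \<open>U\<close> on the
  left and on the right is compensated by the factors \<open>\<surd>(p i)\<close> and \<open>\<surd>(p j)\<close> of the middle matrix.
\<close>

lemma blow_up_factorization:
  fixes p part :: "nat \<Rightarrow> nat" and W :: "nat \<Rightarrow> nat \<Rightarrow> real"
  assumes part: "\<And>a. a < n \<Longrightarrow> part a < t"
    and fibre: "\<And>i. i < t \<Longrightarrow> card {a. a < n \<and> part a = i} = p i"
    and pos: "\<And>i. i < t \<Longrightarrow> p i \<ge> 1"
  defines "U \<equiv> mat n t (\<lambda>(a, i). if part a = i then 1 / sqrt (real (p i)) else 0)"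
  shows "transpose_mat U * U = 1\<^sub>m t"
    and "U * mat t t (\<lambda>(i, j). sqrt (real (p i) * real (p j)) * W i j) * transpose_mat U
       = mat n n (\<lambda>(a, b). W (part a) (part b))"
proof -
  show "transpose_mat U * U = 1\<^sub>m t"
  proof (rule eq_matI)
    fix i j assume "i < dim_row (1\<^sub>m t :: real mat)" "j < dim_col (1\<^sub>m t :: real mat)"
    then have ij: "i < t" "j < t" by auto
    have "(transpose_mat U * U) $$ (i, j)
        = (\<Sum>a<n. if part a = i \<and> i = j then 1 / real (p i) else 0)"
      using ij by (auto simp: U_def scalar_prod_def atLeast0LessThan intro!: sum.cong)
    also have "\<dots> = (\<Sum>a\<in>{a. a < n \<and> part a = i}. if i = j then 1 / real (p i) else 0)"
      by (intro sum.mono_neutral_cong_right) auto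
    also have "\<dots> = (1\<^sub>m t :: real mat) $$ (i, j)"
      using ij fibre[of i] pos[of i] by auto
    finally show "(transpose_mat U * U) $$ (i, j) = (1\<^sub>m t :: real mat) $$ (i, j)" .
  qed (auto simp: U_def)
  let ?S = "mat t t (\<lambda>(i, j). sqrt (real (p i) * real (p j)) * W i j)"
  have US: "U * ?S = mat n t (\<lambda>(a, j). sqrt (real (p j)) * W (part a) j)"
  proof (rule eq_matI, goal_cases)
    case (1 a j)
    then have aj: "a < n" "j < t" by auto
    have "(U * ?S) $$ (a, j)
        = (\<Sum>i<t. if i = part a then 1 / sqrt (real (p i)) * (sqrt (real (p i) * real (p j)) * W i j) else 0)"
      using aj by (auto simp: U_def scalar_prod_def atLeast0LessThan simp del: sum.delta sum.delta'
          intro!: sum.cong)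
    also have "\<dots> = sqrt (real (p j)) * W (part a) j"
      using part[OF aj(1)] pos[of "part a"] by (simp add: real_sqrt_mult)
    finally show ?case using aj by simp
  qed (auto simp: U_def)
  show "U * ?S * transpose_mat U = mat n n (\<lambda>(a, b). W (part a) (part b))"
    unfolding US
  proof (rule eq_matI, goal_cases)
    case (1 a b)
    then have ab: "a < n" "b < n" by auto
    have "(mat n t (\<lambda>(a, j). sqrt (real (p j)) * W (part a) j) * transpose_mat U) $$ (a, b)
        = (\<Sum>j<t. if j = part b then sqrt (real (p j)) * W (part a) j * (1 / sqrt (real (p j))) else 0)"
      using ab by (auto simp: U_def scalar_prod_def atLeast0LessThan simp del: sum.delta sum.delta'
          intro!: sum.cong)
    also have "\<dots> = W (part a) (part b)"
      using part[OF ab(2)] pos[of "part b"] by simp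
    finally show ?case using ab by simp
  qed (auto simp: U_def)
qed

section \<open>Complete multipartite graphs\<close>

lemma (in graph) out_degree_eq_card_neighbours:
  "out_degree G v = card {w. v \<rightarrow>\<^bsub>G\<^esub> w}"
proof -
  have "inj_on (head G) (out_arcs G v)"
    by (rule inj_onI) (auto intro: no_multi_arcs simp: arc_to_ends_def)
  moreover have "head G ` out_arcs G v = {w. v \<rightarrow>\<^bsub>G\<^esub> w}"
    by (auto simp: arcs_ends_def arc_to_ends_def)
  ultimately show ?thesis unfolding out_degree_def by (metis card_image)
qed

lemma complete_multipartite_adjacent_iff:
  assumes G: "complete_multipartite G t P" and u: "u \<in> P i" "i < t" and v: "v \<in> P j" "j < t"
  shows "u \<rightarrow>\<^bsub>G\<^esub> v \<longleftrightarrow> i \<noteq> j"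
proof -
  have uniq: "k = l" if "w \<in> P k" "w \<in> P l" "k < t" "l < t" for w k l
    using G that unfolding complete_multipartite_def disjoint_family_on_def by blast
  have "u \<rightarrow>\<^bsub>G\<^esub> v \<longleftrightarrow> (\<exists>k<t. \<exists>l<t. k \<noteq> l \<and> u \<in> P k \<and> v \<in> P l)"
    using G unfolding complete_multipartite_def by auto
  then show ?thesis using uniq u v by metis
qed

lemma complete_multipartite_out_degree:
  assumes G: "complete_multipartite G t P" and v: "v \<in> P i" "i < t"
  shows "out_degree G v = card (verts G) - card (P i)"
proof -
  interpret graph G using G unfolding complete_multipartite_def by blast
  have verts: "verts G = (\<Union>i<t. P i)" using G unfolding complete_multipartite_def by blast
  have "w \<in> verts G \<and> w \<notin> P i" if "v \<rightarrow>\<^bsub>G\<^esub> w" for w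
  proof -
    have "w \<in> verts G" using that by (rule adj_in_verts)
    then show ?thesis using complete_multipartite_adjacent_iff[OF G v] that v by blast
  qed
  moreover have "v \<rightarrow>\<^bsub>G\<^esub> w" if "w \<in> verts G" "w \<notin> P i" for w
    using that complete_multipartite_adjacent_iff[OF G v] unfolding verts by blast
  ultimately have "{w. v \<rightarrow>\<^bsub>G\<^esub> w} = verts G - P i" by blast
  moreover have "P i \<subseteq> verts G" using v verts by auto
  ultimately show ?thesis
    unfolding out_degree_eq_card_neighbours by (simp add: card_Diff_subset finite_subset)
qed

section \<open>The spectrum of the weighted adjacency matrix\<close>

theorem theorem2p3:
  fixes t n :: nat
    and p d :: "nat \<Rightarrow> nat"
    and G :: "('a, 'b) pre_digraph"
    and P :: "nat \<Rightarrow> 'a set"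
    and vs :: "'a list"
    and \<phi> :: "real \<Rightarrow> real \<Rightarrow> real"
    and A M D S :: "real mat"
  assumes t: "t \<ge> 2"
    and p: "\<And>i. i < t \<Longrightarrow> p i \<ge> 1"
    and n: "n = (\<Sum>i<t. p i)"
    and G: "complete_multipartite G t P"
    and parts: "\<And>i. i < t \<Longrightarrow> card (P i) = p i"
    and d: "\<And>i. i < t \<Longrightarrow> d i = n - p i"
    and vs: "distinct vs" "set vs = verts G"
    and \<phi>_sym: "\<And>x y. x > 0 \<Longrightarrow> y > 0 \<Longrightarrow> \<phi> x y = \<phi> y x"
    and \<phi>_nonzero: "\<And>u v. u \<rightarrow>\<^bsub>G\<^esub> v \<Longrightarrow> \<phi> (real (out_degree G u)) (real (out_degree G v)) \<noteq> 0"
    and A: "A = weighted_adjacency_mat \<phi> G vs"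
    and M: "M = mat t t (\<lambda>(i, j). if i = j then 0 else real (p j) * \<phi> (real (d i)) (real (d j)))"
    and D: "D = mat_diag t (\<lambda>i. real (p i))"
    and S: "S = diag_mat_powr D (1/2) * M * diag_mat_powr D (- 1/2)"
  shows
    "(\<forall>i<t. \<forall>v\<in>P i. out_degree G v = d i)
     \<and> \<comment> \<open>(1)\<close>
     ((\<forall>i<t. S $$ (i, i) = 0)
      \<and> (\<forall>i<t. \<forall>j<t. i \<noteq> j \<longrightarrow>
           S $$ (i, j) = sqrt (real (p i) * real (p j)) * \<phi> (real (d i)) (real (d j)))
      \<and> S \<in> carrier_mat t t \<and> transpose_mat S = S
      \<and> similar_mat M S)
     \<and> \<comment> \<open>(2)\<close>
     (char_poly A = [:0, 1:] ^ (n - t) * det ([:0, 1:] \<cdot>\<^sub>m 1\<^sub>m t - map_mat (\<lambda>a. [:a:]) S))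
     \<and> \<comment> \<open>(3)\<close>
     (Spec A = replicate_mset (n - t) 0 + Spec S
      \<and> Spec A = replicate_mset (n - t) 0 + Spec M)
     \<and> \<comment> \<open>(4)\<close>
     (vec_space.rank n A = vec_space.rank t S
      \<and> count (Spec A) 0 = n - t + kernel_dim S
      \<and> (count (Spec A) 0 = n - t \<longleftrightarrow> invertible_mat S))"
proof -
  define X :: "real poly" where "X = [:0, 1:]"
  define W where "W = (\<lambda>i j. if i = j then 0 else \<phi> (real (d i)) (real (d j)))"
  have p_nz: "p i \<noteq> 0" if "i < t" for i using p[OF that] by simp
  have fin: "finite (P i)" if "i < t" for i
    using p[OF that] parts[OF that] card_gt_0_iff[of "P i"] by linarith
  have disj: "disjoint_family_on P {..<t}" and verts: "verts G = (\<Union>i<t. P i)"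
    using G unfolding complete_multipartite_def by auto
  have card_verts: "card (verts G) = n"
    unfolding verts n using fin disj parts
    by (subst card_UN_disjoint) (auto simp: disjoint_family_on_def)
  have len: "length vs = n" using card_verts vs distinct_card by metis
  have deg: "out_degree G v = d i" if "i < t" "v \<in> P i" for i v
    using complete_multipartite_out_degree[OF G that(2,1)] by (simp add: card_verts parts d that)
  \<comment> \<open>Symmetry of \<open>\<phi>\<close> is available at positive arguments, so the degrees must be positive: as
    \<open>t \<ge> 2\<close>, there is a part other than \<open>i\<close>, and it is nonempty.\<close>
  have d_pos: "d i > 0" if i: "i < t" for i
  proof -
    define j where "j = (if i = 0 then 1 else 0 :: nat)"
    have j: "j < t" "j \<noteq> i" using t by (auto simp: j_def)
    have "p i + p j = (\<Sum>k\<in>{i, j}. p k)" using j by simp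
    also have "\<dots> \<le> n" unfolding n using i j by (intro sum_mono2) auto
    finally show ?thesis using p[OF j(1)] d[OF i] by simp
  qed
  have "t = (\<Sum>i<t. 1)" by simp
  also have "\<dots> \<le> n" unfolding n using p by (intro sum_mono) auto
  finally have tn: "t \<le> n" .

  have powr_D: "diag_mat_powr D a = mat_diag t (\<lambda>i. real (p i) powr a)" for a
    unfolding diag_mat_powr_def D mat_diag_def by (rule eq_matI) auto
  have MC: "M \<in> carrier_mat t t" by (simp add: M)
  have S_eq: "S = mat t t (\<lambda>(i, j). sqrt (real (p i) * real (p j)) * W i j)"
  proof (rule eq_matI, goal_cases)
    case (1 i j)
    then have ij: "i < t" "j < t" by auto
    have "S $$ (i, j) = real (p i) powr (1/2) * M $$ (i, j) * real (p j) powr (- 1/2)"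
      unfolding S powr_D mat_diag_mult_left[OF MC]
      using ij by (subst mat_diag_mult_right[of _ t t]) auto
    also have "\<dots> = sqrt (real (p i) * real (p j)) * W i j"
      using ij p[OF ij(2)] real_div_sqrt[of "real (p j)"]
      by (auto simp: M W_def powr_minus_divide powr_half_sqrt real_sqrt_mult field_simps)
    finally show ?case using ij by simp
  qed (simp_all add: S powr_D mat_diag_def)
  have SC: "S \<in> carrier_mat t t" unfolding S_eq by simp
  have W_sym: "W i j = W j i" if "i < t" "j < t" for i j
    using \<phi>_sym d_pos that unfolding W_def by simp
  have S_sym: "transpose_mat S = S"
    unfolding S_eq by (rule eq_matI) (auto simp: W_sym mult.commute)
  have "similar_mat S M"
  proof (rule similar_matI)
    show "S = diag_mat_powr D (1/2) * M * diag_mat_powr D (- 1/2)" by (rule S)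
    show "diag_mat_powr D (1/2) * diag_mat_powr D (- 1/2) = 1\<^sub>m t"
      unfolding powr_D mat_diag_diag
      by (intro eq_matI) (auto simp: mat_diag_def p_nz simp flip: powr_add)
    show "diag_mat_powr D (- 1/2) * diag_mat_powr D (1/2) = 1\<^sub>m t"
      unfolding powr_D mat_diag_diag
      by (intro eq_matI) (auto simp: mat_diag_def p_nz simp flip: powr_add)
  qed (use SC MC in \<open>simp add: powr_D\<close>)
  then have MS: "similar_mat M S" by (rule similar_mat_sym)

  have "\<forall>a<n. \<exists>i<t. vs ! a \<in> P i"
    using vs(2) verts len by (metis UN_E lessThan_iff nth_mem)
  then obtain part where part: "part a < t" "vs ! a \<in> P (part a)" if "a < n" for a
    by metis
  have part_iff: "part a = i \<longleftrightarrow> vs ! a \<in> P i" if "a < n" "i < t" for a i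
    using part[OF that(1)] that disj unfolding disjoint_family_on_def by blast
  have fibre: "card {a. a < n \<and> part a = i} = p i" if i: "i < t" for i
  proof -
    have "bij_betw (\<lambda>a. vs ! a) {a. a < n \<and> part a = i} (P i)"
    proof (rule bij_betw_imageI)
      show "inj_on (\<lambda>a. vs ! a) {a. a < n \<and> part a = i}"
        using vs(1) len by (auto simp: inj_on_def nth_eq_iff_index_eq)
      show "(\<lambda>a. vs ! a) ` {a. a < n \<and> part a = i} = P i"
      proof (intro equalityI subsetI)
        fix x assume x: "x \<in> P i"
        then have "x \<in> set vs" using vs(2) verts i by auto
        then obtain a where "a < n" "x = vs ! a" using len by (auto simp: in_set_conv_nth)
        then show "x \<in> (\<lambda>a. vs ! a) ` {a. a < n \<and> part a = i}" using part_iff[of a i] i x by blast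
      qed (use part(2) in blast)
    qed
    then show ?thesis using parts[OF i] bij_betw_same_card by metis
  qed
  have A_eq: "A = mat n n (\<lambda>(a, b). W (part a) (part b))"
    unfolding A weighted_adjacency_mat_def len
    by (rule eq_matI)
      (auto simp: complete_multipartite_adjacent_iff[OF G part(2,1) part(2,1)] deg[OF part] W_def)
  have AC: "A \<in> carrier_mat n n" unfolding A_eq by simp
  have A_sym: "transpose_mat A = A"
    unfolding A_eq by (rule eq_matI) (auto simp: W_sym part)

  define U where "U = mat n t (\<lambda>(a, i). if part a = i then 1 / sqrt (real (p i)) else 0)"
  have UC: "U \<in> carrier_mat n t" by (simp add: U_def)
  have iso: "transpose_mat U * U = 1\<^sub>m t"
    unfolding U_def by (rule blow_up_factorization(1)) (use part(1) fibre p in auto)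
  have A_factor: "A = U * S * transpose_mat U"
    unfolding U_def A_eq S_eq
    by (rule blow_up_factorization(2)[symmetric]) (use part(1) fibre p in auto)
  have char_A: "char_poly A = X ^ (n - t) * char_poly S"
    unfolding A_factor X_def by (rule char_poly_isometric_conjugate[OF UC SC tn iso])
  have char_S: "char_poly S = det (X \<cdot>\<^sub>m 1\<^sub>m t - map_mat (\<lambda>a. [:a:]) S)"
    unfolding char_poly_defs X_def
    by (rule arg_cong[of _ _ det], rule eq_matI) (use SC in auto)

  interpret mp: map_poly_inj_idom_divide_hom complex_of_real ..
  have "map_poly complex_of_real (char_poly A) = [:0, 1:] ^ (n - t) * map_poly complex_of_real (char_poly S)"
    unfolding char_A X_def mp.hom_mult mp.hom_power by (simp add: of_real_hom.map_poly_pCons_hom)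
  then have Spec_A: "Spec A = replicate_mset (n - t) 0 + Spec S"
    unfolding Spec_eq_proots_char_poly[OF AC] Spec_eq_proots_char_poly[OF SC]
    using char_poly_nonzero[OF SC] by (simp add: proots_mult proots_power)
  have Spec_M: "Spec M = Spec S"
    unfolding Spec_eq_proots_char_poly[OF MC] Spec_eq_proots_char_poly[OF SC]
      char_poly_similar[OF MS] ..

  \<comment> \<open>\<open>S\<close> and \<open>A\<close> are both symmetric, so for both the multiplicity of 0 is the dimension of the kernel;
    with rank-nullity on both sides, the excess \<open>n - t\<close> cancels in the ranks.\<close>
  have ker_S: "count (Spec S) 0 = kernel_dim S"
    unfolding count_Spec_0[OF SC] by (rule symmetric_real_order_0_char_poly[OF SC S_sym])
  have count_A: "count (Spec A) 0 = n - t + kernel_dim S"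
    unfolding Spec_A using ker_S by simp
  then have ker_A: "kernel_dim A = n - t + kernel_dim S"
    unfolding count_Spec_0[OF AC] symmetric_real_order_0_char_poly[OF AC A_sym] .
  have rank: "vec_space.rank n A = vec_space.rank t S"
    using rank_plus_kernel_dim[OF AC] rank_plus_kernel_dim[OF SC] ker_A tn by linarith
  have "kernel_dim S = 0 \<longleftrightarrow> invertible_mat S"
    unfolding invertible_mat_iff_rank[OF SC] using rank_plus_kernel_dim[OF SC] by linarith
  then have "count (Spec A) 0 = n - t \<longleftrightarrow> invertible_mat S" unfolding count_A by simp
  then show ?thesis
    using deg SC S_sym MS char_A char_S Spec_A Spec_M rank count_A
    unfolding X_def by (auto simp: S_eq W_def)
qed

end
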